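(* Let $n$ be a positive integer. A toroidal anti-queen Latin square of order $n$ produced by the shifting method exists if and only if $n$ is coprime with $6$.
   Context: A Latin square of order $n$ is an $n\times n$ table filled with the integers $1,\dots,n$ so that each integer appears exactly once in each row and in each column. A toroidal anti-queen Latin square is a Latin square in which no two distinct cells separated by a chess queen's move on the torus contain the same number; here the square is viewed as a torus (left and right edges identified, top and bottom edges identified), so that distinct cells $(i,j)$ and $(i',j')$ are separated by a queen's move if $i=i'$, or $j=j'$, or $i-i'\equiv \pm(j-j') \pmod n$. A square is produced by the shifting method if its first row is a permutation of $1,\dots,n$ and, for some fixed integer $k$ and a fixed direction (left or right), each subsequent row is the cyclic shift by $k$ in that direction of the previous row. *)

theory Defs
  imports "HOL-Number_Theory.Cong"
begin

text \<open>
  A square of order \<open>n\<close> is a function \<open>L\<close>, with \<open>L i j\<close> the entry in row \<open>i\<close> and column \<open>j\<close>.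
  Rows and columns are numbered from \<open>0\<close> to \<open>n - 1\<close>, the least residues modulo \<open>n\<close>, so that
  positions on the torus are added modulo \<open>n\<close>; entries are the integers from \<open>1\<close> to \<open>n\<close>.
  Values of \<open>L\<close> outside this range of positions are irrelevant.
\<close>

definition latin_square :: "int \<Rightarrow> (int \<Rightarrow> int \<Rightarrow> int) \<Rightarrow> bool" where
  "latin_square n L \<longleftrightarrow>
     (\<forall>i\<in>{0..<n}. \<forall>j\<in>{0..<n}. L i j \<in> {1..n}) \<and>
     (\<forall>i\<in>{0..<n}. \<forall>v\<in>{1..n}. \<exists>!j. j \<in> {0..<n} \<and> L i j = v) \<and>
     (\<forall>j\<in>{0..<n}. \<forall>v\<in>{1..n}. \<exists>!i. i \<in> {0..<n} \<and> L i j = v)"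

definition toroidal_queen_move :: "int \<Rightarrow> int \<times> int \<Rightarrow> int \<times> int \<Rightarrow> bool" where
  "toroidal_queen_move n = (\<lambda>(i, j) (i', j').
     (i, j) \<noteq> (i', j') \<and>
     (i = i' \<or> j = j' \<or> [i - i' = j - j'] (mod n) \<or> [i - i' = - (j - j')] (mod n)))"

definition toroidal_anti_queen_latin_square :: "int \<Rightarrow> (int \<Rightarrow> int \<Rightarrow> int) \<Rightarrow> bool" where
  "toroidal_anti_queen_latin_square n L \<longleftrightarrow>
     latin_square n L \<and>
     (\<forall>i\<in>{0..<n}. \<forall>j\<in>{0..<n}. \<forall>i'\<in>{0..<n}. \<forall>j'\<in>{0..<n}.
        toroidal_queen_move n (i, j) (i', j') \<longrightarrow> L i j \<noteq> L i' j')"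

datatype direction = Leftward | Rightward

text \<open>
  After a shift of a row to the left by \<open>k\<close>, position \<open>j\<close> holds what was at position
  \<open>j + k\<close> modulo \<open>n\<close>; after a shift to the right, what was at \<open>j - k\<close> modulo \<open>n\<close>.
\<close>

fun cyclic_shift :: "int \<Rightarrow> direction \<Rightarrow> int \<Rightarrow> (int \<Rightarrow> int) \<Rightarrow> int \<Rightarrow> int" where
  "cyclic_shift n Leftward k r j = r ((j + k) mod n)"
| "cyclic_shift n Rightward k r j = r ((j - k) mod n)"

definition produced_by_shifting :: "int \<Rightarrow> (int \<Rightarrow> int \<Rightarrow> int) \<Rightarrow> bool" where
  "produced_by_shifting n L \<longleftrightarrow>
     bij_betw (L 0) {0..<n} {1..n} \<and>
     (\<exists>k d. \<forall>i\<in>{0..<n - 1}. \<forall>j\<in>{0..<n}. L (i + 1) j = cyclic_shift n d k (L i) j)"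

end

theory Submission
  imports Defs
begin

text \<open>
  Shifting by a signed amount \<open>s\<close> makes the entry at \<open>(i, j)\<close> a one-to-one function of
  \<open>j + s i\<close> modulo \<open>n\<close>. Columns and the two kinds of diagonals then avoid repetition exactly
  when \<open>s\<close>, \<open>s - 1\<close> and \<open>s + 1\<close> are units modulo \<open>n\<close>. One of these three consecutive
  integers is divisible by 3 and at least one by 2, so \<open>n\<close> is coprime to 6; conversely
  \<open>s = 2\<close> works for such \<open>n\<close>.
\<close>

lemma eq_if_dvd_diff:
  fixes n x y :: int
  assumes "x \<in> {0..<n}" "y \<in> {0..<n}" "n dvd x - y"
  shows "x = y"
  using assms by (metis atLeastLessThan_iff mod_eq_dvd_iff mod_pos_pos_trivial)

lemma produced_by_shifting_entry:
  assumes "produced_by_shifting n L"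
  obtains s where "\<And>i j. i \<in> {0..<n} \<Longrightarrow> j \<in> {0..<n} \<Longrightarrow> L i j = L 0 ((j + s * i) mod n)"
proof -
  obtain k d where step:
    "\<And>i j. i \<in> {0..<n - 1} \<Longrightarrow> j \<in> {0..<n} \<Longrightarrow> L (i + 1) j = cyclic_shift n d k (L i) j"
    using assms unfolding produced_by_shifting_def by blast
  define s where "s = (case d of Leftward \<Rightarrow> k | Rightward \<Rightarrow> - k)"
  have shift: "cyclic_shift n d k r j = r ((j + s) mod n)" for r j
    by (cases d) (simp_all add: s_def)
  \<comment> \<open>Row \<open>m + 1\<close> reads row \<open>m\<close> at the column
    \<open>(j + s) mod n\<close>, so the induction hypothesis is needed at a column other than
    \<open>j\<close>.\<close>
  have entry: "L (int m) j = L 0 ((j + s * int m) mod n)"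
    if "int m < n" "j \<in> {0..<n}" for m j
    using that
  proof (induction m arbitrary: j)
    case 0
    then show ?case by simp
  next
    case (Suc m)
    have "L (int m + 1) j = L (int m) ((j + s) mod n)"
      using step[of "int m" j] Suc.prems shift by simp
    also have "\<dots> = L 0 (((j + s) mod n + s * int m) mod n)"
      using Suc.prems by (intro Suc.IH) auto
    also have "((j + s) mod n + s * int m) mod n = (j + s * (int m + 1)) mod n"
      by (simp add: mod_simps algebra_simps)
    finally show ?case by (simp add: add.commute)
  qed
  show thesis
  proof (rule that)
    fix i j assume "i \<in> {0..<n}" "j \<in> {0..<n}"
    then show "L i j = L 0 ((j + s * i) mod n)"
      using entry[of "nat i" j] by simp
  qed
qed

text \<open>Along the line through the origin that moves \<open>e\<close> columns per row (a column
  for \<open>e = 0\<close>, a diagonal otherwise), row \<open>i\<close> holds the first-row entry at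
  position \<open>(s + e) * i\<close> modulo \<open>n\<close>. A common factor \<open>p\<close> of
  \<open>n\<close> and \<open>s + e\<close> brings this position back to 0 after
  \<open>n / p\<close> rows, which repeats the entry at the origin.\<close>

lemma coprime_if_anti_queen_shift:
  assumes "n > 0" and anti: "toroidal_anti_queen_latin_square n L"
    and entry: "\<And>i j. i \<in> {0..<n} \<Longrightarrow> j \<in> {0..<n} \<Longrightarrow> L i j = L 0 ((j + s * i) mod n)"
    and e: "e \<in> {-1, 0, 1}"
  shows "coprime n (s + e)"
proof (rule ccontr)
  assume "\<not> coprime n (s + e)"
  define p where "p = gcd n (s + e)"
  have "p > 0" using \<open>n > 0\<close> by (simp add: p_def)
  moreover have "p \<noteq> 1" using \<open>\<not> coprime n (s + e)\<close> by (simp add: p_def coprime_iff_gcd_eq_1)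
  ultimately have "p > 1" by linarith
  obtain d where d: "n = p * d" using p_def by (metis dvdE gcd_dvd1)
  obtain c where c: "s + e = p * c" using p_def by (metis dvdE gcd_dvd2)
  \<comment> \<open>Positivity makes the cell in row \<open>d\<close> differ from the origin;
    \<open>d < n\<close>, which comes from \<open>p > 1\<close>, keeps it inside the square.\<close>
  have "d > 0" using d \<open>n > 0\<close> \<open>p > 1\<close> by (simp add: zero_less_mult_iff)
  then have "d < n" using d \<open>p > 1\<close> by simp
  define j where "j = (e * d) mod n"
  have j: "j \<in> {0..<n}" using \<open>n > 0\<close> by (simp add: j_def)
  have "(j + s * d) mod n = ((s + e) * d) mod n"
    by (simp add: j_def mod_simps algebra_simps)
  also have "\<dots> = 0" by (simp add: c d)
  finally have "L d j = L 0 0"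
    using entry[of d j] j \<open>d > 0\<close> \<open>d < n\<close> by simp
  moreover have "toroidal_queen_move n (d, j) (0, 0)"
    using e \<open>d > 0\<close> unfolding toroidal_queen_move_def
    by (auto simp: j_def cong_def mod_minus_eq)
  ultimately show False
    using anti j \<open>d > 0\<close> \<open>d < n\<close> \<open>n > 0\<close> unfolding toroidal_anti_queen_latin_square_def by auto
qed

lemma coprime_6_if_coprime_consecutive:
  fixes n s :: int
  assumes "coprime n (s - 1)" "coprime n s" "coprime n (s + 1)"
  shows "coprime n 6"
proof -
  have "coprime n ((s - 1) * s * (s + 1))" using assms by simp
  moreover have "6 dvd (s - 1) * s * (s + 1)"
  proof -
    have "even ((s - 1) * s * (s + 1))" by simp
    moreover have "3 dvd (s - 1) * s * (s + 1)"
    proof -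
      have "3 dvd s - 1 \<or> 3 dvd s \<or> 3 dvd s + 1" by presburger
      then show ?thesis by auto
    qed
    ultimately show ?thesis
      using divides_mult[of "2::int" _ 3] by simp
  qed
  ultimately show ?thesis by (meson coprime_divisors dvd_refl)
qed

text \<open>The square with first row 1, ..., n in increasing order and leftward shift
  \<open>s\<close>; the final \<open>+ 1\<close> turns residues into entries.\<close>

definition linear_square :: "int \<Rightarrow> int \<Rightarrow> int \<Rightarrow> int \<Rightarrow> int" where
  "linear_square n s i j = (j + s * i) mod n + 1"

text \<open>Rows, columns and diagonals are all handled by this one linear condition on the
  differences of coordinates.\<close>

lemma linear_square_eq_iff:
  "linear_square n s i j = linear_square n s i' j' \<longleftrightarrow> n dvd (j - j') + s * (i - i')"
  by (simp add: linear_square_def mod_eq_dvd_iff algebra_simps)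

lemma produced_by_shifting_linear_square: "produced_by_shifting n (linear_square n s)"
proof -
  have "bij_betw (\<lambda>j. j + 1) {0..<n} {1..n}"
    by (rule bij_betw_byWitness[where f' = "\<lambda>j. j - 1"]) auto
  then have "bij_betw (linear_square n s 0) {0..<n} {1..n}"
    by (rule bij_betw_cong[THEN iffD1, rotated]) (simp add: linear_square_def)
  moreover have "linear_square n s (i + 1) j = cyclic_shift n Leftward s (linear_square n s i) j"
    for i j
    by (simp add: linear_square_def mod_simps algebra_simps)
  ultimately show ?thesis unfolding produced_by_shifting_def by blast
qed

lemma latin_square_linear_square:
  assumes "n > 0" "coprime n s"
  shows "latin_square n (linear_square n s)"
  unfolding latin_square_def
proof (intro conjI ballI)
  fix i j show "linear_square n s i j \<in> {1..n}"
    using \<open>n > 0\<close> by (auto simp: linear_square_def add1_zle_eq)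
next
  fix i v :: int assume v: "v \<in> {1..n}"
  show "\<exists>!j. j \<in> {0..<n} \<and> linear_square n s i j = v"
  proof (rule ex_ex1I)
    have "linear_square n s i ((v - 1 - s * i) mod n) = v"
      using v by (simp add: linear_square_def mod_add_left_eq)
    then show "\<exists>j. j \<in> {0..<n} \<and> linear_square n s i j = v"
      using \<open>n > 0\<close> by (intro exI[of _ "(v - 1 - s * i) mod n"]) simp
  next
    fix j j' assume
      "j \<in> {0..<n} \<and> linear_square n s i j = v" "j' \<in> {0..<n} \<and> linear_square n s i j' = v"
    then show "j = j'"
      using linear_square_eq_iff[of n s i j i j'] by (auto intro: eq_if_dvd_diff[of _ n])
  qed
next
  fix j v :: int assume v: "v \<in> {1..n}"
  show "\<exists>!i. i \<in> {0..<n} \<and> linear_square n s i j = v"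
  proof (rule ex_ex1I)
    \<comment> \<open>Within a column, \<open>j + s * i = v - 1\<close> modulo \<open>n\<close> has
      to be solved for \<open>i\<close>, hence the inverse \<open>t\<close> of \<open>s\<close>;
      within a row, subtraction was enough.\<close>
    obtain t where t: "[s * t = 1] (mod n)"
      using \<open>coprime n s\<close> cong_solve_coprime_int[of s n] by (auto simp: coprime_commute)
    define i where "i = (t * (v - 1 - j)) mod n"
    have "[s * i = s * t * (v - 1 - j)] (mod n)"
      by (simp add: i_def cong_def mod_mult_right_eq mult.assoc)
    also have "[s * t * (v - 1 - j) = 1 * (v - 1 - j)] (mod n)"
      using t by (rule cong_scalar_right)
    finally have "[j + s * i = v - 1] (mod n)"
      using cong_add[OF cong_refl[of j]] by fastforce
    then have "linear_square n s i j = v"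
      using v by (simp add: linear_square_def cong_def)
    then show "\<exists>i. i \<in> {0..<n} \<and> linear_square n s i j = v"
      using \<open>n > 0\<close> by (intro exI[of _ i]) (simp add: i_def)
  next
    fix i i' assume
      "i \<in> {0..<n} \<and> linear_square n s i j = v" "i' \<in> {0..<n} \<and> linear_square n s i' j = v"
    then show "i = i'"
      using linear_square_eq_iff[of n s i j i' j] \<open>coprime n s\<close>
      by (auto simp: coprime_dvd_mult_right_iff intro: eq_if_dvd_diff[of _ n])
  qed
qed

text \<open>Two equal entries on a line of slope \<open>e\<close> satisfy two congruences, whose
  difference is \<open>(s + e) * (i - i') = 0\<close> modulo \<open>n\<close>. Since
  \<open>s + e\<close> is a unit, both cells lie in the same row, and there all entries are
  distinct.\<close>

lemma anti_queen_linear_square: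
  assumes "n > 0" "coprime n s" "coprime n (s - 1)" "coprime n (s + 1)"
  shows "toroidal_anti_queen_latin_square n (linear_square n s)"
  unfolding toroidal_anti_queen_latin_square_def
proof (intro conjI ballI impI notI)
  show "latin_square n (linear_square n s)"
    using assms by (intro latin_square_linear_square)
next
  fix i j i' j'
  assume in_range: "i \<in> {0..<n}" "j \<in> {0..<n}" "i' \<in> {0..<n}" "j' \<in> {0..<n}"
    and move: "toroidal_queen_move n (i, j) (i', j')"
    and same: "linear_square n s i j = linear_square n s i' j'"
  from same have dvd: "n dvd (j - j') + s * (i - i')"
    by (simp add: linear_square_eq_iff)
  have neq: "(i, j) \<noteq> (i', j')" using move by (simp add: toroidal_queen_move_def)
  have "i \<noteq> i'"
    using dvd neq in_range by (auto intro: eq_if_dvd_diff[of _ n])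
  then have not_dvd: "\<not> n dvd i - i'"
    using in_range eq_if_dvd_diff by blast
  \<comment> \<open>The values 0, 1 and -1 of \<open>e\<close> stand for the column and the two
    diagonal directions.\<close>
  have no_line: "\<not> n dvd (j - j') - e * (i - i')" if "coprime n (s + e)" for e
  proof
    assume "n dvd (j - j') - e * (i - i')"
    with dvd have "n dvd ((j - j') + s * (i - i')) - ((j - j') - e * (i - i'))"
      by (rule dvd_diff)
    then have "n dvd (s + e) * (i - i')" by (simp add: algebra_simps)
    with that not_dvd show False by (simp add: coprime_dvd_mult_right_iff)
  qed
  from move \<open>i \<noteq> i'\<close> consider "j = j'" | "[i - i' = j - j'] (mod n)"
    | "[i - i' = - (j - j')] (mod n)"
    unfolding toroidal_queen_move_def by auto
  then show False
  proof cases
    case 1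
    then show False using no_line[of 0] assms by simp
  next
    case 2
    then show False using no_line[of 1] assms by (auto simp: cong_iff_dvd_diff dvd_diff_commute)
  next
    case 3
    then show False using no_line[of "-1"] assms
      by (auto simp: cong_iff_dvd_diff algebra_simps)
  qed
qed

theorem corollary12:
  fixes n :: int
  assumes "n > 0"
  shows "(\<exists>L. toroidal_anti_queen_latin_square n L \<and> produced_by_shifting n L) \<longleftrightarrow> coprime n 6"
proof
  assume "\<exists>L. toroidal_anti_queen_latin_square n L \<and> produced_by_shifting n L"
  then obtain L where anti: "toroidal_anti_queen_latin_square n L"
    and "produced_by_shifting n L" by blast
  then obtain s where
    "\<And>i j. i \<in> {0..<n} \<Longrightarrow> j \<in> {0..<n} \<Longrightarrow> L i j = L 0 ((j + s * i) mod n)"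
    using produced_by_shifting_entry by blast
  note coprime = coprime_if_anti_queen_shift[OF \<open>n > 0\<close> anti this]
  show "coprime n 6"
    using coprime[of "-1"] coprime[of 0] coprime[of 1]
    by (intro coprime_6_if_coprime_consecutive[of n s]) simp_all
next
  assume "coprime n 6"
  \<comment> \<open>With \<open>s = 2\<close>, the numbers \<open>s - 1\<close>, \<open>s\<close>
    and \<open>s + 1\<close> are 1, 2 and 3, all divisors of 6.\<close>
  then have "coprime n 2" "coprime n 3"
    by (auto intro: coprime_divisors[of n n _ 6])
  then have "toroidal_anti_queen_latin_square n (linear_square n 2)"
    using \<open>n > 0\<close> by (intro anti_queen_linear_square) simp_all
  then show "\<exists>L. toroidal_anti_queen_latin_square n L \<and> produced_by_shifting n L"
    using produced_by_shifting_linear_square by blast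
qed

end
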